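(* Let $(X,d)$ be a metric space, let $\mathcal U$ be the family of unbounded subsets of $X$, and let $\sim$ denote linear equivalence on $\mathcal U$. Then $(\mathcal U/{\sim},t)$ is a complete metric space.
   Context: Fix a reference point $o\in X$ and let $B(x,r)=\{y\in X: d(y,x)\le r\}$. For $R\subseteq X$ and $\alpha,a\ge0$ put $\alpha R+a=\bigcup_{x\in R}B(x,\alpha d(o,x)+a)$. For $R,S\subseteq X$ let $s^+(R,S)$ be the infimum of all $\alpha\ge0$ such that $S\subseteq\alpha R+a$ for some $a\ge0$; put $s(R,S)=\max\{s^+(R,S),s^+(S,R)\}$ and $t(R,S)=\sqrt{s(R,S)}$. Two unbounded subsets $R,S$ are linearly equivalent, $R\sim S$, if $s(R,S)=0$; this is an equivalence relation on $\mathcal U$, and $t$ on $\mathcal U/{\sim}$ is given by $t([R],[S])=t(R,S)$, which is well defined. *)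

theory Defs
  imports "HOL-Analysis.Analysis"
begin

context Metric_space
begin

definition unbounded_sets :: "'a set set"
  where "unbounded_sets = {R. R \<subseteq> M \<and> \<not> mbounded R}"

text \<open>The set \<open>\<alpha> R + a\<close>, with reference point \<open>z\<close>.\<close>

definition lin_enlarge :: "'a \<Rightarrow> real \<Rightarrow> 'a set \<Rightarrow> real \<Rightarrow> 'a set"
  where "lin_enlarge z \<alpha> R a = (\<Union>x\<in>R. mcball x (\<alpha> * d z x + a))"

text \<open>
  The infimum is taken in \<open>[0, \<infinity>]\<close>, so that it is \<open>\<infinity>\<close> if no \<open>\<alpha>\<close> is admissible.
  This does not happen when the first set is unbounded: see \<open>s_plus_le_1\<close>.
\<close>

definition s_plus :: "'a \<Rightarrow> 'a set \<Rightarrow> 'a set \<Rightarrow> ennreal"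
  where "s_plus z R S = Inf (ennreal ` {\<alpha>. 0 \<le> \<alpha> \<and> (\<exists>a\<ge>0. S \<subseteq> lin_enlarge z \<alpha> R a)})"

definition s_dist :: "'a \<Rightarrow> 'a set \<Rightarrow> 'a set \<Rightarrow> ennreal"
  where "s_dist z R S = max (s_plus z R S) (s_plus z S R)"

text \<open>On unbounded sets \<open>s_dist\<close> is finite, so \<open>enn2real\<close> loses nothing there.\<close>

definition t_dist :: "'a \<Rightarrow> 'a set \<Rightarrow> 'a set \<Rightarrow> real"
  where "t_dist z R S = sqrt (enn2real (s_dist z R S))"

definition lin_equiv :: "'a \<Rightarrow> ('a set \<times> 'a set) set"
  where "lin_equiv z =
    {(R, S). R \<in> unbounded_sets \<and> S \<in> unbounded_sets \<and> s_dist z R S = 0}"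

text \<open>
  \<open>t\<close> on equivalence classes, evaluated at chosen representatives;
  independence of the choice is \<open>t_quot_class\<close> below.
\<close>

definition t_quot :: "'a \<Rightarrow> 'a set set \<Rightarrow> 'a set set \<Rightarrow> real"
  where "t_quot z C D = t_dist z (SOME R. R \<in> C) (SOME S. S \<in> D)"

lemma s_plus_le:
  assumes "0 \<le> \<alpha>" "0 \<le> a" "S \<subseteq> lin_enlarge z \<alpha> R a"
  shows "s_plus z R S \<le> ennreal \<alpha>"
  unfolding s_plus_def using assms by (intro INF_lower) auto

lemma s_plus_lessE:
  assumes "s_plus z R S < ennreal e"
  obtains \<alpha> a where "0 \<le> \<alpha>" "\<alpha> < e" "0 \<le> a" "S \<subseteq> lin_enlarge z \<alpha> R a"
proof -
  obtain \<alpha> a where "0 \<le> \<alpha>" "ennreal \<alpha> < ennreal e" "0 \<le> a" "S \<subseteq> lin_enlarge z \<alpha> R a"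
    using assms unfolding s_plus_def by (auto simp: Inf_less_iff)
  then show ?thesis
    using that by (simp add: ennreal_less_iff)
qed

lemma s_plus_le_1:
  assumes z: "z \<in> M" and R: "R \<in> unbounded_sets" and S: "S \<subseteq> M"
  shows "s_plus z R S \<le> 1"
proof (rule ennreal_le_epsilon)
  fix e :: real assume e: "0 < e"
  have "\<exists>x\<in>R. d y x \<le> (1 + e) * d z x" if y: "y \<in> S" for y
  proof -
    have "\<not> R \<subseteq> mcball z (d z y / e)"
      using R by (auto simp: unbounded_sets_def mbounded_def)
    then obtain x where x: "x \<in> R" "x \<in> M" "d z y / e < d z x"
      using z R by (force simp: unbounded_sets_def)
    have "d z y \<le> e * d z x"
      using x e by (simp add: field_simps)
    moreover have "d y x \<le> d z y + d z x"
      using triangle''[of y z x] x y z S by auto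
    ultimately show ?thesis
      using x by (auto simp: algebra_simps intro!: bexI[of _ x])
  qed
  then have "S \<subseteq> lin_enlarge z (1 + e) R 0"
    using S R by (fastforce simp: lin_enlarge_def unbounded_sets_def commute)
  then have "s_plus z R S \<le> ennreal (1 + e)"
    using e by (intro s_plus_le) auto
  then show "s_plus z R S \<le> 1 + ennreal e"
    using e by (simp flip: ennreal_1 ennreal_plus)
qed

lemma lin_enlarge_trans:
  assumes z: "z \<in> M" and RM: "R \<subseteq> M"
    and \<alpha>: "0 \<le> \<alpha>" and S: "S \<subseteq> lin_enlarge z \<alpha> R a"
    and T: "T \<subseteq> lin_enlarge z \<beta> S b" and \<beta>: "0 \<le> \<beta>"
  shows "T \<subseteq> lin_enlarge z (\<alpha> + \<beta> + \<alpha> * \<beta>) R (\<beta> * a + a + b)"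
proof
  fix w assume "w \<in> T"
  then obtain y where y: "y \<in> S" "y \<in> M" "w \<in> M" "d y w \<le> \<beta> * d z y + b"
    using T by (auto simp: lin_enlarge_def)
  then obtain x where x: "x \<in> R" "x \<in> M" "d x y \<le> \<alpha> * d z x + a"
    using S by (auto simp: lin_enlarge_def)
  have "d z y \<le> d z x + d x y"
    using x y z by (intro triangle)
  also have "\<dots> \<le> d z x + (\<alpha> * d z x + a)"
    using x by simp
  finally have "\<beta> * d z y \<le> \<beta> * (d z x + (\<alpha> * d z x + a))"
    using \<beta> by (rule mult_left_mono)
  moreover have "d x w \<le> d x y + d y w"
    using x y by (intro triangle)
  ultimately have "d x w \<le> (\<alpha> + \<beta> + \<alpha> * \<beta>) * d z x + (\<beta> * a + a + b)"
    using x y by (simp add: algebra_simps)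
  then show "w \<in> lin_enlarge z (\<alpha> + \<beta> + \<alpha> * \<beta>) R (\<beta> * a + a + b)"
    using x y by (auto simp: lin_enlarge_def)
qed

lemma s_plus_cong_left:
  assumes z: "z \<in> M" and RM: "R \<subseteq> M" and 0: "s_plus z R S = 0"
  shows "s_plus z R T \<le> s_plus z S T"
  unfolding s_plus_def[of z S T]
proof (rule INF_greatest)
  fix \<beta> assume "\<beta> \<in> {\<alpha>. 0 \<le> \<alpha> \<and> (\<exists>a\<ge>0. T \<subseteq> lin_enlarge z \<alpha> S a)}"
  then obtain b where \<beta>: "0 \<le> \<beta>" "0 \<le> b" "T \<subseteq> lin_enlarge z \<beta> S b"
    by auto
  show "s_plus z R T \<le> ennreal \<beta>"
  proof (rule ennreal_le_epsilon)
    fix e :: real assume e: "0 < e"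
    have "s_plus z R S < ennreal (e / (1 + \<beta>))"
      using e \<beta> 0 by (simp add: ennreal_zero_less_divide)
    then obtain \<alpha> a where \<alpha>: "0 \<le> \<alpha>" "\<alpha> < e / (1 + \<beta>)" "0 \<le> a" "S \<subseteq> lin_enlarge z \<alpha> R a"
      by (rule s_plus_lessE)
    have "s_plus z R T \<le> ennreal (\<alpha> + \<beta> + \<alpha> * \<beta>)"
      using \<alpha> \<beta> lin_enlarge_trans[OF z RM \<alpha>(1,4) \<beta>(3,1)]
      by (intro s_plus_le[where a = "\<beta> * a + a + b"]) auto
    also have "\<dots> \<le> ennreal (\<beta> + e)"
      using \<alpha> \<beta> by (intro ennreal_leI) (simp add: field_simps)
    finally show "s_plus z R T \<le> ennreal \<beta> + ennreal e"
      using e \<beta> by simp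
  qed
qed

lemma s_plus_cong_right:
  assumes z: "z \<in> M" and RM: "R \<subseteq> M" and 0: "s_plus z S T = 0"
  shows "s_plus z R T \<le> s_plus z R S"
  unfolding s_plus_def[of z R S]
proof (rule INF_greatest)
  fix \<alpha> assume "\<alpha> \<in> {\<alpha>. 0 \<le> \<alpha> \<and> (\<exists>a\<ge>0. S \<subseteq> lin_enlarge z \<alpha> R a)}"
  then obtain a where \<alpha>: "0 \<le> \<alpha>" "0 \<le> a" "S \<subseteq> lin_enlarge z \<alpha> R a"
    by auto
  show "s_plus z R T \<le> ennreal \<alpha>"
  proof (rule ennreal_le_epsilon)
    fix e :: real assume e: "0 < e"
    have "s_plus z S T < ennreal (e / (1 + \<alpha>))"
      using e \<alpha> 0 by (simp add: ennreal_zero_less_divide)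
    then obtain \<beta> b where \<beta>: "0 \<le> \<beta>" "\<beta> < e / (1 + \<alpha>)" "0 \<le> b" "T \<subseteq> lin_enlarge z \<beta> S b"
      by (rule s_plus_lessE)
    have "s_plus z R T \<le> ennreal (\<alpha> + \<beta> + \<alpha> * \<beta>)"
      using \<alpha> \<beta> lin_enlarge_trans[OF z RM \<alpha>(1,3) \<beta>(4,1)]
      by (intro s_plus_le[where a = "\<beta> * a + a + b"]) auto
    also have "\<dots> \<le> ennreal (\<alpha> + e)"
      using \<alpha> \<beta> by (intro ennreal_leI) (simp add: field_simps)
    finally show "s_plus z R T \<le> ennreal \<alpha> + ennreal e"
      using e \<alpha> by simp
  qed
qed

lemma s_plus_refl:
  assumes "R \<subseteq> M"
  shows "s_plus z R R = 0"
proof -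
  have "R \<subseteq> lin_enlarge z 0 R 0"
    using assms by (auto simp: lin_enlarge_def)
  then show ?thesis
    using s_plus_le[of 0 0 R z R] by simp
qed

lemma equiv_lin_equiv:
  assumes z: "z \<in> M"
  shows "equiv unbounded_sets (lin_equiv z)"
proof (intro equivI refl_onI symI transI)
  show "lin_equiv z \<subseteq> unbounded_sets \<times> unbounded_sets"
    by (auto simp: lin_equiv_def)
next
  fix R assume "R \<in> unbounded_sets"
  then show "(R, R) \<in> lin_equiv z"
    by (auto simp: lin_equiv_def s_dist_def unbounded_sets_def s_plus_refl)
next
  fix R S assume "(R, S) \<in> lin_equiv z"
  then show "(S, R) \<in> lin_equiv z"
    by (auto simp: lin_equiv_def s_dist_def max.commute)
next
  fix R S T assume "(R, S) \<in> lin_equiv z" "(S, T) \<in> lin_equiv z"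
  then have *: "R \<in> unbounded_sets" "T \<in> unbounded_sets" "R \<subseteq> M" "T \<subseteq> M"
    "s_plus z R S = 0" "s_plus z S R = 0" "s_plus z S T = 0" "s_plus z T S = 0"
    by (auto simp: lin_equiv_def s_dist_def unbounded_sets_def max_def split: if_splits)
  have "s_plus z R T = 0" "s_plus z T R = 0"
    using s_plus_cong_left[OF z, of R S T] s_plus_cong_left[OF z, of T S R] * by auto
  then show "(R, T) \<in> lin_equiv z"
    using * by (auto simp: lin_equiv_def s_dist_def)
qed

lemma t_dist_cong:
  assumes z: "z \<in> M" and R: "(R, R') \<in> lin_equiv z" and S: "(S, S') \<in> lin_equiv z"
  shows "t_dist z R S = t_dist z R' S'"
proof -
  have *: "R \<subseteq> M" "R' \<subseteq> M" "S \<subseteq> M" "S' \<subseteq> M"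
    "s_plus z R R' = 0" "s_plus z R' R = 0" "s_plus z S S' = 0" "s_plus z S' S = 0"
    using R S
    by (auto simp: lin_equiv_def s_dist_def unbounded_sets_def max_def split: if_splits)
  have eq: "s_plus z A B = s_plus z A' B'"
    if "A \<subseteq> M" "A' \<subseteq> M" "s_plus z A A' = 0" "s_plus z A' A = 0"
      "s_plus z B B' = 0" "s_plus z B' B = 0" for A A' B B'
    using s_plus_cong_left[OF z that(1,3), of B] s_plus_cong_left[OF z that(2,4), of B]
      s_plus_cong_right[OF z that(2,5)] s_plus_cong_right[OF z that(2,6)]
    by (metis order_antisym)
  have "s_plus z R S = s_plus z R' S'" "s_plus z S R = s_plus z S' R'"
    using * by (auto intro!: eq)
  then show ?thesis
    by (simp add: t_dist_def s_dist_def)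
qed

lemma t_quot_class:
  assumes z: "z \<in> M" and R: "R \<in> unbounded_sets" and S: "S \<in> unbounded_sets"
  shows "t_quot z (lin_equiv z `` {R}) (lin_equiv z `` {S}) = t_dist z R S"
proof -
  have *: "(A, SOME B. B \<in> lin_equiv z `` {A}) \<in> lin_equiv z" if "A \<in> unbounded_sets" for A
  proof -
    have "A \<in> lin_equiv z `` {A}"
      using equiv_class_self[OF equiv_lin_equiv[OF z] that] .
    then have "(SOME B. B \<in> lin_equiv z `` {A}) \<in> lin_equiv z `` {A}"
      by (rule someI)
    then show ?thesis
      by auto
  qed
  show ?thesis
    unfolding t_quot_def using t_dist_cong[OF z *[OF R] *[OF S]] by simp
qed

end

end

theory Submission
  imports Defs
begin

text \<open>
  Composing an \<open>\<alpha>\<close>-enlargement with a \<open>\<beta>\<close>-enlargement gives an enlargement with factor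
  \<open>\<alpha> + \<beta> + \<alpha> \<beta>\<close>, so \<open>s\<close> itself need not satisfy the triangle inequality. On unbounded sets,
  however, \<open>s \<le> 1\<close>, and \<open>u\<^sup>2 + v\<^sup>2 + u\<^sup>2 v\<^sup>2 \<le> (u + v)\<^sup>2\<close> as soon as \<open>u v \<le> 2\<close>; the square
  root therefore repairs the defect (\<open>t_dist_triangle\<close>). The remaining metric axioms on the
  quotient are immediate, as \<open>t = 0\<close> is linear equivalence by definition.

  For completeness, let \<open>R\<^sub>0, R\<^sub>1, \<dots>\<close> be a Cauchy sequence and write \<open>|x|\<close> for \<open>d z x\<close>. The limit
  is glued from annular pieces: \<open>S\<close> consists of those \<open>x \<in> R\<^sub>m\<close> with
  \<open>r\<^sub>m \<le> |x| \<le> 4 r\<^sub>m\<^sub>+\<^sub>1\<close>, where \<open>r\<^sub>0 \<le> r\<^sub>1 \<le> \<dots>\<close> tends to infinity so fast that at distance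
  \<open>r\<^sub>m\<close> from \<open>z\<close> the additive constants in the comparisons of \<open>R\<^sub>m\<close> with the earlier sets are
  negligible against the linear terms. Such radii exist because at stage \<open>m\<close> only finitely
  many constants matter (\<open>absorbing_radii\<close>). A point of the \<open>m\<close>-th piece is then linearly close to a point of
  \<open>R\<^sub>n\<close> for every large \<open>n \<le> m\<close>, while the pieces with \<open>m < n\<close> lie in a fixed ball and only cost
  an additive constant. Conversely, a point \<open>x \<in> R\<^sub>n\<close> with \<open>2 r\<^sub>m \<le> |x| \<le> 2 r\<^sub>m\<^sub>+\<^sub>1\<close>, where \<open>m \<ge> n\<close>, is close to a
  point of \<open>R\<^sub>m\<close> whose distance to \<open>z\<close> differs from \<open>|x|\<close> at most by a factor \<open>2\<close>, and the
  overlap of the annuli puts that point into \<open>S\<close> (\<open>t_dist_Cauchy_limit\<close>).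
\<close>

section \<open>The metric\<close>

context Metric_space
begin

lemma unbounded_sets_far:
  assumes "z \<in> M" "R \<in> unbounded_sets"
  obtains x where "x \<in> R" "x \<in> M" "c < d z x"
proof -
  have "\<not> R \<subseteq> mcball z c"
    using assms by (auto simp: unbounded_sets_def mbounded_def)
  then show ?thesis
    using that assms by (force simp: unbounded_sets_def)
qed

lemma s_dist_finite:
  assumes "z \<in> M" "R \<in> unbounded_sets" "S \<in> unbounded_sets"
  shows "s_dist z R S < top"
proof -
  have "s_dist z R S \<le> 1"
    using assms s_plus_le_1[of z R S] s_plus_le_1[of z S R]
    by (auto simp: s_dist_def unbounded_sets_def)
  then show ?thesis
    using ennreal_one_less_top by (rule order.strict_trans1)
qed

lemma t_dist_nonneg: "0 \<le> t_dist z R S"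
  by (simp add: t_dist_def)

lemma t_dist_commute: "t_dist z R S = t_dist z S R"
  by (simp add: t_dist_def s_dist_def max.commute)

lemma s_dist_eq_t_dist_square:
  assumes "z \<in> M" "R \<in> unbounded_sets" "S \<in> unbounded_sets"
  shows "s_dist z R S = ennreal ((t_dist z R S)\<^sup>2)"
  using s_dist_finite[OF assms] by (simp add: t_dist_def)

lemma t_dist_less_iff:
  assumes "z \<in> M" "R \<in> unbounded_sets" "S \<in> unbounded_sets" "0 < u"
  shows "t_dist z R S < u \<longleftrightarrow> s_plus z R S < ennreal (u\<^sup>2) \<and> s_plus z S R < ennreal (u\<^sup>2)"
proof -
  have "t_dist z R S < u \<longleftrightarrow> (t_dist z R S)\<^sup>2 < u\<^sup>2"
    using assms(4) t_dist_nonneg[of z R S] by (auto intro: power_strict_mono power2_less_imp_less)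
  also have "\<dots> \<longleftrightarrow> s_dist z R S < ennreal (u\<^sup>2)"
    using s_dist_eq_t_dist_square[OF assms(1-3)] by (simp add: ennreal_less_iff)
  finally show ?thesis
    by (simp add: s_dist_def)
qed

lemma t_dist_le:
  assumes "z \<in> M" "R \<in> unbounded_sets" "S \<in> unbounded_sets" "0 \<le> u"
    and "s_plus z R S \<le> ennreal (u\<^sup>2)" "s_plus z S R \<le> ennreal (u\<^sup>2)"
  shows "t_dist z R S \<le> u"
proof -
  have "ennreal ((t_dist z R S)\<^sup>2) \<le> ennreal (u\<^sup>2)"
    using s_dist_eq_t_dist_square[OF assms(1-3)] assms(5,6) by (metis s_dist_def max.bounded_iff)
  then show ?thesis
    using assms(4) by (auto intro: power2_le_imp_le)
qed

lemma t_dist_le_1: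
  assumes "z \<in> M" "R \<in> unbounded_sets" "S \<in> unbounded_sets"
  shows "t_dist z R S \<le> 1"
  using assms s_plus_le_1[of z R S] s_plus_le_1[of z S R]
  by (intro t_dist_le) (auto simp: unbounded_sets_def)

lemma s_plus_compose:
  assumes "z \<in> M" "R \<subseteq> M" and RS: "s_plus z R S < ennreal \<alpha>" and ST: "s_plus z S T < ennreal \<beta>"
  shows "s_plus z R T \<le> ennreal (\<alpha> + \<beta> + \<alpha> * \<beta>)"
proof -
  obtain \<alpha>' a where a: "0 \<le> \<alpha>'" "\<alpha>' < \<alpha>" "0 \<le> a" "S \<subseteq> lin_enlarge z \<alpha>' R a"
    using RS by (rule s_plus_lessE)
  obtain \<beta>' b where b: "0 \<le> \<beta>'" "\<beta>' < \<beta>" "0 \<le> b" "T \<subseteq> lin_enlarge z \<beta>' S b"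
    using ST by (rule s_plus_lessE)
  have "s_plus z R T \<le> ennreal (\<alpha>' + \<beta>' + \<alpha>' * \<beta>')"
    using a b lin_enlarge_trans[OF assms(1,2) a(1,4) b(4,1)]
    by (intro s_plus_le[where a = "\<beta>' * a + a + b"]) auto
  also have "\<dots> \<le> ennreal (\<alpha> + \<beta> + \<alpha> * \<beta>)"
    using a b by (intro ennreal_leI add_mono mult_mono) auto
  finally show ?thesis .
qed

text \<open>
  With \<open>u\<close> and \<open>v\<close> slightly above the two distances, which are at most \<open>1\<close>, the product \<open>u v\<close>
  stays below \<open>2\<close>, so that the composed factor \<open>u\<^sup>2 + v\<^sup>2 + u\<^sup>2 v\<^sup>2\<close> is at most \<open>(u + v)\<^sup>2\<close>.
\<close>

lemma t_dist_triangle: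
  assumes z: "z \<in> M" and R: "R \<in> unbounded_sets" and S: "S \<in> unbounded_sets"
    and T: "T \<in> unbounded_sets"
  shows "t_dist z R T \<le> t_dist z R S + t_dist z S T"
proof (rule field_le_epsilon)
  fix e :: real assume e: "0 < e"
  define h where "h = min (e / 2) (1 / 4)"
  define u where "u = t_dist z R S + h"
  define v where "v = t_dist z S T + h"
  have h: "0 < h" "h \<le> 1 / 4" "2 * h \<le> e"
    using e by (auto simp: h_def)
  have uv: "0 < u" "u \<le> 5 / 4" "0 < v" "v \<le> 5 / 4"
    using h t_dist_le_1[OF z R S] t_dist_le_1[OF z S T] t_dist_nonneg[of z R S]
      t_dist_nonneg[of z S T] by (auto simp: u_def v_def)
  have "u * v \<le> 5 / 4 * (5 / 4)"
    using uv by (intro mult_mono) auto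
  then have "(u * v) * (u * v) \<le> 2 * (u * v)"
    using uv by (intro mult_right_mono) auto
  then have le: "u\<^sup>2 + v\<^sup>2 + u\<^sup>2 * v\<^sup>2 \<le> (u + v)\<^sup>2"
    by (simp add: power2_eq_square algebra_simps)
  have sub: "R \<subseteq> M" "T \<subseteq> M"
    using R T by (auto simp: unbounded_sets_def)
  have "t_dist z R S < u" "t_dist z S T < v"
    using h by (auto simp: u_def v_def)
  then have s: "s_plus z R S < ennreal (u\<^sup>2)" "s_plus z S R < ennreal (u\<^sup>2)"
    "s_plus z S T < ennreal (v\<^sup>2)" "s_plus z T S < ennreal (v\<^sup>2)"
    using uv by (simp_all add: t_dist_less_iff z R S T)
  have "t_dist z R T \<le> u + v"
  proof (intro t_dist_le z R T)
    show "s_plus z R T \<le> ennreal ((u + v)\<^sup>2)"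
      using s_plus_compose[OF z sub(1) s(1,3)] ennreal_leI[OF le] by (rule order_trans)
    show "s_plus z T R \<le> ennreal ((u + v)\<^sup>2)"
      using s_plus_compose[OF z sub(2) s(4,2)] ennreal_leI[OF le]
      by (simp add: algebra_simps)
  qed (use uv in auto)
  then show "t_dist z R T \<le> t_dist z R S + t_dist z S T + e"
    using h by (simp add: u_def v_def)
qed

lemma t_dist_eq_0_iff:
  assumes "z \<in> M" "R \<in> unbounded_sets" "S \<in> unbounded_sets"
  shows "t_dist z R S = 0 \<longleftrightarrow> (R, S) \<in> lin_equiv z"
  using s_dist_eq_t_dist_square[OF assms] assms(2,3) by (auto simp: lin_equiv_def)

lemma Metric_space_t_quot:
  assumes z: "z \<in> M"
  shows "Metric_space (unbounded_sets // lin_equiv z) (t_quot z)"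
proof
  show "0 \<le> t_quot z C D" for C D
    by (simp add: t_quot_def t_dist_nonneg)
  show "t_quot z C D = t_quot z D C" for C D
    by (simp add: t_quot_def t_dist_commute)
next
  fix C D
  assume "C \<in> unbounded_sets // lin_equiv z" "D \<in> unbounded_sets // lin_equiv z"
  then obtain R S where "R \<in> unbounded_sets" "C = lin_equiv z `` {R}"
    and "S \<in> unbounded_sets" "D = lin_equiv z `` {S}"
    by (auto elim!: quotientE)
  then show "t_quot z C D = 0 \<longleftrightarrow> C = D"
    by (simp only: t_quot_class[OF z] t_dist_eq_0_iff[OF z]
        eq_equiv_class_iff[OF equiv_lin_equiv[OF z]])
next
  fix C D E
  assume "C \<in> unbounded_sets // lin_equiv z" "D \<in> unbounded_sets // lin_equiv z"
    "E \<in> unbounded_sets // lin_equiv z"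
  then show "t_quot z C E \<le> t_quot z C D + t_quot z D E"
    by (auto elim!: quotientE simp: t_quot_class z intro!: t_dist_triangle)
qed

end

section \<open>Completeness\<close>

text \<open>
  One sequence of radii can dominate countably many constants because only those with indices
  \<open>j, n \<le> m\<close> have to be dominated at stage \<open>m\<close>.
\<close>

lemma diagonal_majorant:
  fixes f :: "nat \<Rightarrow> nat \<Rightarrow> nat \<Rightarrow> real"
  assumes f: "\<And>j n m. 0 \<le> f j n m"
  obtains r :: "nat \<Rightarrow> real"
  where "mono r" "\<And>m. real m \<le> r m" "\<And>j n m. j \<le> m \<Longrightarrow> n \<le> m \<Longrightarrow> f j n m \<le> r m"
proof -
  define g where "g m = (\<Sum>j\<le>m. \<Sum>n\<le>m. f j n m)" for m
  define r where "r m = real m + (\<Sum>k\<le>m. g k)" for m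
  have g: "0 \<le> g m" for m
    unfolding g_def by (intro sum_nonneg f)
  show ?thesis
  proof
    show "mono r"
      using g by (auto simp: r_def mono_iff_le_Suc)
    show "real m \<le> r m" for m
      using g by (simp add: r_def sum_nonneg)
    show "f j n m \<le> r m" if "j \<le> m" "n \<le> m" for j n m
    proof -
      have "f j n m \<le> (\<Sum>n\<le>m. f j n m)"
        using that f by (intro member_le_sum) auto
      also have "\<dots> \<le> g m"
        unfolding g_def using that f
        by (intro member_le_sum[of j _ "\<lambda>j. \<Sum>n\<le>m. f j n m"] sum_nonneg) auto
      also have "\<dots> \<le> (\<Sum>k\<le>m. g k)"
        using g by (intro member_le_sum) auto
      also have "\<dots> \<le> r m"
        by (simp add: r_def)
      finally show ?thesis .
    qed
  qed
qed

lemma mono_unbounded_bracket: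
  fixes r :: "nat \<Rightarrow> real"
  assumes r: "\<And>m. real m \<le> r m" and c: "r n \<le> c" and "mono r"
  obtains m where "n \<le> m" "r m \<le> c" "c < r (Suc m)"
proof -
  have ex: "\<exists>k. c < r k"
    using reals_Archimedean2[of c] r order_less_le_trans by blast
  define k where "k = (LEAST k. c < r k)"
  have k: "c < r k"
    unfolding k_def using ex by (rule LeastI_ex)
  have "n < k"
    using k c monoD[OF \<open>mono r\<close>, of k n] by (meson leI not_less order_trans)
  then obtain m where m: "k = Suc m" "n \<le> m"
    by (cases k) auto
  have "\<not> c < r m"
    using m not_less_Least[of m "\<lambda>k. c < r k"] by (simp add: k_def)
  then show ?thesis
    using that k m by auto
qed

context Metric_space
begin

lemma lin_enlarge_mono:
  assumes "R \<subseteq> M" "\<alpha> \<le> \<beta>"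
  shows "lin_enlarge z \<alpha> R a \<subseteq> lin_enlarge z \<beta> R a"
proof
  fix y assume "y \<in> lin_enlarge z \<alpha> R a"
  then obtain x where x: "x \<in> R" "x \<in> M" "y \<in> M" "d x y \<le> \<alpha> * d z x + a"
    by (auto simp: lin_enlarge_def)
  have "\<alpha> * d z x \<le> \<beta> * d z x"
    using assms(2) by (intro mult_right_mono) auto
  then show "y \<in> lin_enlarge z \<beta> R a"
    using x by (force simp: lin_enlarge_def)
qed

text \<open>Bounded parts of \<open>S\<close> only contribute to the additive constant.\<close>

lemma s_plus_le_outside_ball:
  assumes z: "z \<in> M" and x0: "x0 \<in> R" and R: "R \<subseteq> M" and S: "S \<subseteq> M" and \<alpha>: "0 \<le> \<alpha>"
    and far: "\<And>y. y \<in> S \<Longrightarrow> c < d z y \<Longrightarrow> \<exists>x\<in>R. d x y \<le> \<alpha> * d z x"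
  shows "s_plus z R S \<le> ennreal \<alpha>"
proof (rule s_plus_le)
  define a where "a = d z x0 + \<bar>c\<bar>"
  show a: "0 \<le> a"
    by (simp add: a_def)
  show "S \<subseteq> lin_enlarge z \<alpha> R a"
  proof
    fix y assume y: "y \<in> S"
    have "\<exists>x\<in>R. d x y \<le> \<alpha> * d z x + a"
    proof (cases "c < d z y")
      case True
      then obtain x where "x \<in> R" "d x y \<le> \<alpha> * d z x"
        using far y by blast
      then show ?thesis
        using a by (intro bexI[of _ x]) auto
    next
      case False
      have "d x0 y \<le> d z x0 + d z y"
        using triangle'[of x0 z y] x0 R S y z by (auto simp: commute)
      moreover have "0 \<le> \<alpha> * d z x0"
        using \<alpha> by simp
      ultimately show ?thesis
        using False x0 by (intro bexI[of _ x0]) (auto simp: a_def)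
    qed
    then show "y \<in> lin_enlarge z \<alpha> R a"
      using R S y by (auto simp: lin_enlarge_def)
  qed
qed fact

text \<open>
  The additive error \<open>a\<close> is absorbed by the linear one when \<open>y\<close> is far out; then
  \<open>d x y \<le> e (|x| + |y|)\<close>, which makes \<open>|x|\<close> and \<open>|y|\<close> comparable when \<open>e\<close> is small.
\<close>

lemma absorb_constant:
  assumes M: "z \<in> M" "x \<in> M" "y \<in> M" and e: "0 \<le> e" "e \<le> 1 / 4"
    and d: "d x y \<le> e * d z x + a" and a: "a \<le> e * d z y"
  shows "d x y \<le> 3 * e * d z x" "d z x \<le> 2 * d z y" "d z y \<le> 2 * d z x"
proof -
  have tri: "d z y \<le> d z x + d x y" "d z x \<le> d z y + d x y"
    using triangle[of z x y] triangle[of z y x] M by (auto simp: commute)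
  have e': "e * d z x \<le> 1 / 4 * d z x" "e * d z y \<le> 1 / 4 * d z y"
    using mult_right_mono[OF e(2)] nonneg by auto
  show "d z x \<le> 2 * d z y" and le: "d z y \<le> 2 * d z x"
    using tri e' d a nonneg[of z x] nonneg[of z y] by linarith+
  have "e * d z y \<le> e * (2 * d z x)"
    using le e by (intro mult_left_mono)
  then show "d x y \<le> 3 * e * d z x"
    using d a by (simp add: algebra_simps)
qed

text \<open>
  Beyond \<open>r m\<close>, the set \<open>R m\<close> can be compared with each earlier \<open>R n\<close>, in both directions,
  without an additive constant: \<open>r m\<close> is chosen so large that \<open>r m / (j + 4)\<close> is at least the two
  constants that belong to the slope \<open>1 / (j + 4)\<close>. The condition \<open>max k l = m\<close> covers both
  directions at once, and the shift by \<open>4\<close> keeps every slope in the range in which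
  \<open>absorb_constant\<close> applies. Using \<open>1 / (j + 4)\<close> only for \<open>j \<le> m\<close> is what makes the number of
  constants at stage \<open>m\<close> finite.
\<close>

lemma absorbing_radii:
  fixes R :: "nat \<Rightarrow> 'a set"
  assumes z: "z \<in> M" and R: "\<And>n. R n \<subseteq> M"
  shows "\<exists>r::nat \<Rightarrow> real. mono r \<and> (\<forall>m. real m \<le> r m) \<and>
    (\<forall>j m k l. s_plus z (R k) (R l) < ennreal (1 / real (j + 4)) \<longrightarrow> j \<le> m \<longrightarrow> max k l = m \<longrightarrow>
      (\<forall>y\<in>R l. r m \<le> d z y \<longrightarrow>
        (\<exists>x\<in>R k. d x y \<le> 3 / real (j + 4) * d z x \<and> d z x \<le> 2 * d z y \<and> d z y \<le> 2 * d z x)))"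
proof -
  let ?e = "\<lambda>j::nat. 1 / real (j + 4)"
  have ex: "\<exists>a\<ge>0. s_plus z (R k) (R l) < ennreal (?e j) \<longrightarrow> R l \<subseteq> lin_enlarge z (?e j) (R k) a"
    for j k l
  proof (cases "s_plus z (R k) (R l) < ennreal (?e j)")
    case True
    then obtain \<alpha> a where "\<alpha> < ?e j" "0 \<le> a" "R l \<subseteq> lin_enlarge z \<alpha> (R k) a"
      by (rule s_plus_lessE)
    then show ?thesis
      using lin_enlarge_mono[OF R, of \<alpha> "?e j" z k a] by (intro exI[of _ a]) auto
  qed auto
  define a where "a j k l = (SOME a. 0 \<le> a \<and> (s_plus z (R k) (R l) < ennreal (?e j) \<longrightarrow>
    R l \<subseteq> lin_enlarge z (?e j) (R k) a))" for j k l
  have a0: "0 \<le> a j k l"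
    and a: "s_plus z (R k) (R l) < ennreal (?e j) \<Longrightarrow> R l \<subseteq> lin_enlarge z (?e j) (R k) (a j k l)"
    for j k l
    using someI_ex[OF ex[of k l j]] by (simp_all add: a_def)
  obtain r where r: "mono r" "\<And>m. real m \<le> r m"
    and ar: "\<And>j n m. j \<le> m \<Longrightarrow> n \<le> m \<Longrightarrow> real (j + 4) * (a j n m + a j m n) \<le> r m"
    using diagonal_majorant[of "\<lambda>j n m. real (j + 4) * (a j n m + a j m n)"] a0 by auto
  show ?thesis
  proof (intro exI[of _ r] conjI allI impI ballI r)
    fix j m k l y
    assume s: "s_plus z (R k) (R l) < ennreal (?e j)" and j: "j \<le> m" and m: "max k l = m"
      and y: "y \<in> R l" "r m \<le> d z y"
    obtain x where x: "x \<in> R k" "x \<in> M" "y \<in> M" "d x y \<le> ?e j * d z x + a j k l"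
      using a[OF s] y by (auto simp: lin_enlarge_def)
    have "real (j + 4) * a j k l \<le> real (j + 4) * (a j (min k l) m + a j m (min k l))"
      using m a0[of j k l] a0[of j l k] by (intro mult_left_mono) (auto simp: min_def max_def)
    also have "\<dots> \<le> r m"
      using j m by (intro ar) auto
    finally have "a j k l \<le> ?e j * d z y"
      using y by (simp add: field_simps)
    then have "d x y \<le> 3 * ?e j * d z x" "d z x \<le> 2 * d z y" "d z y \<le> 2 * d z x"
      using absorb_constant[OF z x(2,3) _ _ x(4)] by auto
    then show "\<exists>x\<in>R k. d x y \<le> 3 / real (j + 4) * d z x \<and> d z x \<le> 2 * d z y \<and> d z y \<le> 2 * d z x"
      using x(1) by (intro bexI[of _ x]) auto
  qed
qed

text \<open>
  The pieces of \<open>S\<close> use overlapping annuli: moving from \<open>R n\<close> to \<open>R m\<close> may change the distance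
  to \<open>z\<close> by a factor \<open>2\<close>, so the ranges \<open>[2 r m, 2 r (Suc m)]\<close>, which cover all large distances,
  have to be widened by that factor on both sides.
\<close>

lemma t_dist_Cauchy_limit:
  fixes R :: "nat \<Rightarrow> 'a set"
  assumes z: "z \<in> M" and R: "\<And>n. R n \<in> unbounded_sets"
    and Cauchy: "\<And>u. 0 < u \<Longrightarrow> \<exists>N. \<forall>k\<ge>N. \<forall>l\<ge>N. t_dist z (R k) (R l) < u"
  shows "\<exists>S\<in>unbounded_sets. \<forall>u>0. \<exists>N. \<forall>n\<ge>N. t_dist z (R n) S < u"
proof -
  have RM: "R n \<subseteq> M" for n
    using R by (auto simp: unbounded_sets_def)
  obtain r where r: "mono r" "\<forall>m. real m \<le> r m"
    and close: "\<forall>j m k l. s_plus z (R k) (R l) < ennreal (1 / real (j + 4)) \<longrightarrow> j \<le> m \<longrightarrow> max k l = m \<longrightarrow>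
      (\<forall>y\<in>R l. r m \<le> d z y \<longrightarrow>
        (\<exists>x\<in>R k. d x y \<le> 3 / real (j + 4) * d z x \<and> d z x \<le> 2 * d z y \<and> d z y \<le> 2 * d z x))"
    using absorbing_radii[of z R, OF z RM] by (elim exE conjE) (rule that)
  have r0: "0 \<le> r m" for m
    using r(2)[rule_format, of m] by linarith
  define S where "S = (\<Union>m. {x \<in> R m. r m \<le> d z x \<and> d z x \<le> 4 * r (Suc m)})"
  have SM: "S \<subseteq> M"
    using RM by (auto simp: S_def)
  have s_Cauchy: "\<exists>N\<ge>j. \<forall>k\<ge>N. \<forall>l\<ge>N. s_plus z (R k) (R l) < ennreal (1 / real (j + 4))" for j :: nat
  proof -
    let ?u = "sqrt (1 / real (j + 4))"
    obtain N where N: "\<forall>k\<ge>N. \<forall>l\<ge>N. t_dist z (R k) (R l) < ?u"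
      using Cauchy[of ?u] by auto
    have "s_plus z (R k) (R l) < ennreal (1 / real (j + 4))" if "k \<ge> N" "l \<ge> N" for k l
      using N that t_dist_less_iff[OF z R R, of ?u k l] by simp
    then show ?thesis
      by (intro exI[of _ "max N j"]) auto
  qed
  have near_S: "\<exists>y\<in>S. d y x \<le> 3 / real (j + 4) * d z y \<and> d z x \<le> 2 * d z y"
    if N: "j \<le> N" "\<forall>k\<ge>N. \<forall>l\<ge>N. s_plus z (R k) (R l) < ennreal (1 / real (j + 4))"
      and n: "N \<le> n" and x: "x \<in> R n" "2 * r n \<le> d z x" for j N n x
  proof -
    obtain m where m: "n \<le> m" "r m \<le> d z x / 2" "d z x / 2 < r (Suc m)"
      using mono_unbounded_bracket[of r n "d z x / 2"] r x by auto
    have "r m \<le> d z x"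
      using m r0[of m] by linarith
    then obtain y where y: "y \<in> R m" "d y x \<le> 3 / real (j + 4) * d z y"
      "d z y \<le> 2 * d z x" "d z x \<le> 2 * d z y"
      using close[rule_format, of m n j m x] N n m x by auto
    have "r m \<le> d z y" "d z y \<le> 4 * r (Suc m)"
      using m y by linarith+
    then have "y \<in> S"
      using y by (auto simp: S_def)
    then show ?thesis
      using y by blast
  qed
  have S_far: "\<exists>y\<in>S. c < d z y" for c
  proof -
    obtain N where N: "\<forall>k\<ge>N. \<forall>l\<ge>N. s_plus z (R k) (R l) < ennreal (1 / real (0 + 4))"
      using s_Cauchy[of 0] by blast
    obtain x where x: "x \<in> R N" "2 * r N + 2 * \<bar>c\<bar> < d z x"
      using unbounded_sets_far[OF z R] by blast
    have "2 * r N \<le> d z x"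
      using x by linarith
    then obtain y where "y \<in> S" "d z x \<le> 2 * d z y"
      using near_S[OF _ N order_refl x(1)] by blast
    then show ?thesis
      using x r0[of N] by (intro bexI[of _ y]) auto
  qed
  have "\<not> mbounded S"
  proof
    assume "mbounded S"
    then obtain x B where "S \<subseteq> mcball x B"
      by (auto simp: mbounded_def)
    then have *: "\<And>y. y \<in> S \<Longrightarrow> x \<in> M \<and> y \<in> M \<and> d x y \<le> B"
      by auto
    obtain y where "y \<in> S" "d z x + B < d z y"
      using S_far by blast
    then show False
      using *[of y] triangle[OF z, of x y] by auto
  qed
  then have S: "S \<in> unbounded_sets"
    using SM by (auto simp: unbounded_sets_def)
  show ?thesis
  proof (intro bexI[OF _ S] allI impI)
    fix u :: real assume u: "0 < u"
    obtain j :: nat where "3 / u\<^sup>2 < real j"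
      using reals_Archimedean2 by blast
    then have j: "3 / real (j + 4) < u\<^sup>2"
      using u by (simp add: field_simps) (smt (verit) zero_less_power2)
    obtain N where N: "N \<ge> j" "\<forall>k\<ge>N. \<forall>l\<ge>N. s_plus z (R k) (R l) < ennreal (1 / real (j + 4))"
      using s_Cauchy by blast
    have "t_dist z (R n) S < u" if n: "N \<le> n" for n
    proof -
      obtain y0 where y0: "y0 \<in> S"
        using S_far by blast
      obtain x0 where x0: "x0 \<in> R n"
        using unbounded_sets_far[OF z R] by blast
      have "s_plus z S (R n) \<le> ennreal (3 / real (j + 4))"
        using near_S[OF N n] by (intro s_plus_le_outside_ball[OF z y0 SM RM, where c = "2 * r n"]) force+
      moreover have "s_plus z (R n) S \<le> ennreal (3 / real (j + 4))"
      proof (rule s_plus_le_outside_ball[OF z x0 RM SM])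
        fix x assume "x \<in> S" and x: "4 * r n < d z x"
        then obtain m where m: "x \<in> R m" "r m \<le> d z x" "d z x \<le> 4 * r (Suc m)"
          by (auto simp: S_def)
        \<comment> \<open>Pieces with index below \<open>n\<close> end at \<open>4 r n\<close> at the latest.\<close>
        have "\<not> Suc m \<le> n"
          using monoD[OF r(1), of "Suc m" n] m x by auto
        then show "\<exists>y\<in>R n. d y x \<le> 3 / real (j + 4) * d z y"
          using close[rule_format, of n m j m x] N n m by force
      qed simp
      moreover have "ennreal (3 / real (j + 4)) < ennreal (u\<^sup>2)"
        using j by (simp add: ennreal_less_iff)
      ultimately show ?thesis
        using t_dist_less_iff[OF z R S u] by (meson order.strict_trans1)
    qed
    then show "\<exists>N. \<forall>n\<ge>N. t_dist z (R n) S < u"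
      by blast
  qed
qed

lemma mcomplete_t_quot:
  assumes z: "z \<in> M"
  shows "Metric_space.mcomplete (unbounded_sets // lin_equiv z) (t_quot z)"
proof -
  interpret Q: Metric_space "unbounded_sets // lin_equiv z" "t_quot z"
    by (rule Metric_space_t_quot[OF z])
  show ?thesis
    unfolding Q.mcomplete_def
  proof (intro allI impI)
    fix \<sigma> assume \<sigma>: "Q.MCauchy \<sigma>"
    have "\<exists>R\<in>unbounded_sets. \<sigma> n = lin_equiv z `` {R}" for n
    proof -
      have "\<sigma> n \<in> unbounded_sets // lin_equiv z"
        using \<sigma> by (auto simp: Q.MCauchy_def)
      then show ?thesis
        by (rule quotientE) auto
    qed
    then obtain R where R: "\<And>n. R n \<in> unbounded_sets" "\<And>n. \<sigma> n = lin_equiv z `` {R n}"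
      by metis
    have "\<exists>N. \<forall>k\<ge>N. \<forall>l\<ge>N. t_dist z (R k) (R l) < u" if "0 < u" for u
      using \<sigma> that by (fastforce simp: Q.MCauchy_def R t_quot_class[OF z])
    then obtain S where S: "S \<in> unbounded_sets"
      and lim: "\<forall>u>0. \<exists>N. \<forall>n\<ge>N. t_dist z (R n) S < u"
      using t_dist_Cauchy_limit[of z R, OF z R(1)] by auto
    have "limitin Q.mtopology \<sigma> (lin_equiv z `` {S}) sequentially"
      using lim by (auto simp: Q.limit_metric_sequentially R t_quot_class[OF z] S quotientI)
    then show "\<exists>x. limitin Q.mtopology \<sigma> x sequentially" ..
  qed
qed

end

theorem theorem2p9:
  fixes X :: "'a set" and d :: "'a \<Rightarrow> 'a \<Rightarrow> real" and z :: 'a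
  assumes "Metric_space X d" and "z \<in> X"
  shows "Metric_space
           (Metric_space.unbounded_sets X d // Metric_space.lin_equiv X d z)
           (Metric_space.t_quot X d z) \<and>
         Metric_space.mcomplete
           (Metric_space.unbounded_sets X d // Metric_space.lin_equiv X d z)
           (Metric_space.t_quot X d z)"
  using Metric_space.Metric_space_t_quot[OF assms] Metric_space.mcomplete_t_quot[OF assms] ..

end
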